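(* Let $\varepsilon>0$ and let $I_{11},I_{22}>0$, $I_{13},I_{23}\in\mathbb{R}$ be entries of the inertia tensor. Let $Q$ be the following polynomial in two variables: $$Q(u,v)=\frac1{16}(I_{11}u^2+I_{22}v^2)\Big(16I_{11}I_{22}+\varepsilon^2\big(8I_{11}I_{22}(u^2+v^2)+4(I_{13}u+I_{23}v)^2\big)+4\varepsilon^3uv(I_{22}-I_{11})(I_{13}u+I_{23}v)+\varepsilon^4(I_{11}u^2+I_{22}v^2)(I_{22}u^2+I_{11}v^2)\Big).$$ Consider the (multivalued) discrete system $$p_3^+(u_{k+1},v_{k+1})=p_3^-(u_k,v_k),\qquad q_3^-(u_{k+1},v_{k+1})=q_3^+(u_k,v_k),$$ where $$p_3^\pm(u,v)=I_{11}u\pm\frac\varepsilon2v(I_{13}u+I_{23}v)+\frac{\varepsilon^2}4u(I_{11}u^2+I_{22}v^2),\qquad q_3^\pm(u,v)=I_{22}v\pm\frac\varepsilon2u(I_{13}u+I_{23}v)+\frac{\varepsilon^2}4v(I_{11}u^2+I_{22}v^2).$$ (1) If $I_{11}=I_{22}$, then the discrete system evolves on the level sets of $Q$, i.e. $Q(u_{k+1},v_{k+1})=Q(u_k,v_k)$. (2) If $I_{11}\neq I_{22}$, then for successive points defined by the discrete system we have $Q(u_{k+1},v_{k+1})-Q(u_k,v_k)=\mathcal{O}(\varepsilon^3)$.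
   Context: The numbers $I_{ij}$ are entries of a symmetric positive definite $3\times3$ inertia tensor with $I_{12}=0$. The system is the reduced discrete dynamics, in the coordinates $(u,v)$, of a discretisation of the nonholonomic Suslov problem with time step $\varepsilon$. Given $(u_k,v_k)$ there may be several (real or complex) solutions $(u_{k+1},v_{k+1})$; the result applies to all branches. The estimate $\mathcal{O}(\varepsilon^3)$ is as $\varepsilon\to0$ with $(u_k,v_k)$ fixed. *)

theory Defs
  imports "HOL-Analysis.Analysis"
begin

definition inertia_tensor :: "real^3^3 \<Rightarrow> bool" where
  "inertia_tensor J \<longleftrightarrow> transpose J = J \<and> (\<forall>x. x \<noteq> 0 \<longrightarrow> 0 < x \<bullet> (J *v x))"

text \<open>
  The points of the discrete system are complex, because the implicit equations may have
  non-real solutions; real points are included as complex numbers with vanishing imaginary part.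
  The inertia tensor and the time step \<open>\<epsilon>\<close> stay real.
\<close>

definition Q :: "real^3^3 \<Rightarrow> real \<Rightarrow> complex \<Rightarrow> complex \<Rightarrow> complex" where
  "Q J \<epsilon> u v =
    (let I11 = complex_of_real (J $ 1 $ 1); I22 = complex_of_real (J $ 2 $ 2);
         I13 = complex_of_real (J $ 1 $ 3); I23 = complex_of_real (J $ 2 $ 3);
         e = complex_of_real \<epsilon>
     in 1 / 16 * (I11 * u\<^sup>2 + I22 * v\<^sup>2) *
        (16 * I11 * I22
         + e\<^sup>2 * (8 * I11 * I22 * (u\<^sup>2 + v\<^sup>2) + 4 * (I13 * u + I23 * v)\<^sup>2)
         + 4 * e ^ 3 * u * v * (I22 - I11) * (I13 * u + I23 * v)
         + e ^ 4 * (I11 * u\<^sup>2 + I22 * v\<^sup>2) * (I22 * u\<^sup>2 + I11 * v\<^sup>2)))"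

text \<open>
  The argument \<open>\<sigma>\<close> is the sign of \<open>p\<^sub>3\<^sup>\<plusminus>\<close> and \<open>q\<^sub>3\<^sup>\<plusminus>\<close>, used only with the values \<open>1\<close> and \<open>- 1\<close>.
\<close>

definition p3 :: "complex \<Rightarrow> real^3^3 \<Rightarrow> real \<Rightarrow> complex \<Rightarrow> complex \<Rightarrow> complex" where
  "p3 \<sigma> J \<epsilon> u v =
    (let I11 = complex_of_real (J $ 1 $ 1); I22 = complex_of_real (J $ 2 $ 2);
         I13 = complex_of_real (J $ 1 $ 3); I23 = complex_of_real (J $ 2 $ 3);
         e = complex_of_real \<epsilon>
     in I11 * u + \<sigma> * (e / 2 * v * (I13 * u + I23 * v))
        + e\<^sup>2 / 4 * u * (I11 * u\<^sup>2 + I22 * v\<^sup>2))"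

definition q3 :: "complex \<Rightarrow> real^3^3 \<Rightarrow> real \<Rightarrow> complex \<Rightarrow> complex \<Rightarrow> complex" where
  "q3 \<sigma> J \<epsilon> u v =
    (let I11 = complex_of_real (J $ 1 $ 1); I22 = complex_of_real (J $ 2 $ 2);
         I13 = complex_of_real (J $ 1 $ 3); I23 = complex_of_real (J $ 2 $ 3);
         e = complex_of_real \<epsilon>
     in I22 * v + \<sigma> * (e / 2 * u * (I13 * u + I23 * v))
        + e\<^sup>2 / 4 * v * (I11 * u\<^sup>2 + I22 * v\<^sup>2))"

text \<open>
  The discrete system is multivalued, so one step is a relation:
  \<open>suslov_step J \<epsilon> u v u' v'\<close> says that \<open>(u', v')\<close> is one of the points following \<open>(u, v)\<close>.
\<close>

definition suslov_step ::
  "real^3^3 \<Rightarrow> real \<Rightarrow> complex \<Rightarrow> complex \<Rightarrow> complex \<Rightarrow> complex \<Rightarrow> bool" where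
  "suslov_step J \<epsilon> u v u' v' \<longleftrightarrow>
    p3 1 J \<epsilon> u' v' = p3 (- 1) J \<epsilon> u v \<and> q3 (- 1) J \<epsilon> u' v' = q3 1 J \<epsilon> u v"

end

theory Submission
  imports Defs
begin

text \<open>
  \<open>Q\<close> is the quadratic form \<open>I22 (p3\<^sup>+)\<^sup>2 + I11 (q3\<^sup>-)\<^sup>2\<close>. One step of the system replaces
  \<open>p3\<^sup>+, q3\<^sup>-\<close> at the new point by \<open>p3\<^sup>-, q3\<^sup>+\<close> at the old one, which amounts to
  \<open>\<epsilon> \<mapsto> -\<epsilon>\<close>, and the only odd term of the form in \<open>\<epsilon>\<close> is the cubic one, with factor \<open>I22 - I11\<close>.
  So the increment of \<open>Q\<close> is an explicit function of the old point alone, and the bound is uniform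
  over all branches, including those that escape to infinity as \<open>\<epsilon> \<rightarrow> 0\<close>.
\<close>

text \<open>The weights and the opposite signs make the terms linear in \<epsilon> cancel.\<close>

lemma Q_eq_p3_q3:
  "Q J \<epsilon> u v = complex_of_real (J $ 2 $ 2) * (p3 1 J \<epsilon> u v)\<^sup>2
     + complex_of_real (J $ 1 $ 1) * (q3 (- 1) J \<epsilon> u v)\<^sup>2"
  unfolding Q_def p3_def q3_def Let_def
  by (simp add: field_simps power2_eq_square power3_eq_cube power4_eq_xxxx)

text \<open>Minus twice the coefficient of \<open>\<epsilon> ^ 3\<close> in \<open>Q\<close>: the
  change of \<open>Q\<close> under \<epsilon> \<mapsto> -\<epsilon>, without its factor
  \<open>\<epsilon> ^ 3\<close>.\<close>

definition Q_defect :: "real^3^3 \<Rightarrow> complex \<Rightarrow> complex \<Rightarrow> complex" where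
  "Q_defect J u v =
    (let I11 = complex_of_real (J $ 1 $ 1); I22 = complex_of_real (J $ 2 $ 2);
         I13 = complex_of_real (J $ 1 $ 3); I23 = complex_of_real (J $ 2 $ 3)
     in (I11 - I22) / 2 * u * v * (I13 * u + I23 * v) * (I11 * u\<^sup>2 + I22 * v\<^sup>2))"

lemma Q_add_defect_eq_p3_q3:
  "Q J \<epsilon> u v + complex_of_real \<epsilon> ^ 3 * Q_defect J u v =
     complex_of_real (J $ 2 $ 2) * (p3 (- 1) J \<epsilon> u v)\<^sup>2
     + complex_of_real (J $ 1 $ 1) * (q3 1 J \<epsilon> u v)\<^sup>2"
  unfolding Q_def p3_def q3_def Q_defect_def Let_def
  by (simp add: field_simps power2_eq_square power3_eq_cube power4_eq_xxxx)

lemma suslov_step_Q: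
  assumes "suslov_step J \<epsilon> u v u' v'"
  shows "Q J \<epsilon> u' v' = Q J \<epsilon> u v + complex_of_real \<epsilon> ^ 3 * Q_defect J u v"
  using assms unfolding suslov_step_def Q_add_defect_eq_p3_q3 Q_eq_p3_q3 [of J \<epsilon> u' v'] by simp

theorem proposition7p2:
  fixes J :: "real^3^3"
  assumes "inertia_tensor J" and "J $ 1 $ 2 = 0"
    and "J $ 1 $ 1 > 0" and "J $ 2 $ 2 > 0"
  shows "(J $ 1 $ 1 = J $ 2 $ 2 \<longrightarrow>
            (\<forall>\<epsilon>>0. \<forall>u v u' v'. suslov_step J \<epsilon> u v u' v' \<longrightarrow> Q J \<epsilon> u' v' = Q J \<epsilon> u v))
       \<and> (J $ 1 $ 1 \<noteq> J $ 2 $ 2 \<longrightarrow>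
            (\<forall>u v. \<exists>C>0. \<forall>\<^sub>F \<epsilon> in at_right 0. \<forall>u' v'. suslov_step J \<epsilon> u v u' v' \<longrightarrow>
               norm (Q J \<epsilon> u' v' - Q J \<epsilon> u v) \<le> C * norm (\<epsilon> ^ 3)))"
proof (intro conjI impI allI)
  fix \<epsilon> :: real and u v u' v'
  assume "J $ 1 $ 1 = J $ 2 $ 2" and step: "suslov_step J \<epsilon> u v u' v'"
  then have "Q_defect J u v = 0"
    by (simp add: Q_defect_def)
  with suslov_step_Q [OF step] show "Q J \<epsilon> u' v' = Q J \<epsilon> u v"
    by simp
next
  fix u v
  \<comment> \<open>The \<open>+ 1\<close> keeps the constant positive where the defect vanishes, as
    at \<open>u = 0\<close>.\<close>
  have bound: "norm (Q J \<epsilon> u' v' - Q J \<epsilon> u v) \<le> (norm (Q_defect J u v) + 1) * norm (\<epsilon> ^ 3)"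
    if "suslov_step J \<epsilon> u v u' v'" for \<epsilon> u' v'
    using suslov_step_Q [OF that]
    by (simp add: norm_mult norm_power power_abs algebra_simps)
  show "\<exists>C>0. \<forall>\<^sub>F \<epsilon> in at_right 0. \<forall>u' v'. suslov_step J \<epsilon> u v u' v' \<longrightarrow>
          norm (Q J \<epsilon> u' v' - Q J \<epsilon> u v) \<le> C * norm (\<epsilon> ^ 3)"
  \<comment> \<open>The increment formula is exact, so the bound holds for every \<epsilon>.\<close>
  proof (intro exI conjI always_eventually allI impI)
    show "0 < norm (Q_defect J u v) + 1"
      by (simp add: add_nonneg_pos)
  qed (rule bound)
qed

end
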